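(* Let $(A,\mu,\alpha,\beta)$ be a regular BiHom-alternative algebra, let $A^+=(A,\mu',\alpha,\beta)$ be its plus BiHom-Jordan algebra, where $\mu'(x,y)=\mu(x,y)+\mu(\alpha^{-1}\beta(y),\beta^{-1}\alpha(x))$, and let $(V,\phi,\psi)$ be a BiHom-module. (1) If $(V,\phi,\psi)$ is a right BiHom-alternative $A$-module with structure map $\rho_r$, then $(V,\phi,\psi)$ is a right special BiHom-Jordan $A^+$-module with the same structure map $\rho_r$. (2) If $(V,\phi,\psi)$ is a left BiHom-alternative $A$-module with structure map $\rho_l$ and $\psi$ is invertible, then $(V,\phi,\psi)$ is a left special BiHom-Jordan $A^+$-module with the same structure map $\rho_l$.
   Context: $\mathbb{K}$ is an algebraically closed field of characteristic $0$; all vector spaces and (multi)linear maps are over $\mathbb{K}$. A BiHom-algebra $(A,\mu,\alpha,\beta)$ is a vector space $A$ with a bilinear map $\mu:A\times A\to A$ and linear maps $\alpha,\beta:A\to A$ with $\alpha\beta=\beta\alpha$. It is multiplicative if $\alpha(\mu(x,y))=\mu(\alpha(x),\alpha(y))$ and $\beta(\mu(x,y))=\mu(\beta(x),\beta(y))$ for all $x,y$. It is regular if $\alpha,\beta$ are algebra automorphisms. Its BiHom-associator is $as_{\alpha,\beta}(x,y,z)=\mu(\mu(x,y),\beta(z))-\mu(\alpha(x),\mu(y,z))$. A BiHom-alternative algebra is a multiplicative BiHom-algebra with $as_{\alpha,\beta}(\beta(x),\alpha(y),z)+as_{\alpha,\beta}(\beta(y),\alpha(x),z)=0$ and $as_{\alpha,\beta}(x,\beta(y),\alpha(z))+as_{\alpha,\beta}(x,\beta(z),\alpha(y))=0$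 for all $x,y,z$. A BiHom-Jordan algebra is a multiplicative BiHom-algebra with $\mu(\beta(x),\alpha(y))=\mu(\beta(y),\alpha(x))$ and $as_{\alpha,\beta}(\mu(\beta^2(x),\alpha\beta(x)),\alpha^2\beta(y),\alpha^3(x))=0$ for all $x,y$. It is known that $A^+$ is BiHom-Jordan when $A$ is a regular BiHom-alternative algebra. A BiHom-module $(V,\phi,\psi)$ is a vector space with commuting linear self-maps $\phi,\psi$. A left structure map is a linear map $\rho_l:A\otimes V\to V$, $a\otimes v\mapsto a\cdot v$, with $\phi\rho_l=\rho_l(\alpha\otimes\phi)$, $\psi\rho_l=\rho_l(\beta\otimes\psi)$; a right structure map is a linear map $\rho_r:V\otimes A\to V$, $v\otimes a\mapsto v\cdot a$, with $\phi\rho_r=\rho_r(\phi\otimes\alpha)$, $\psi\rho_r=\rho_r(\psi\otimes\beta)$. Left BiHom-alternative $A$-module: BiHom-module with left structure map such that $as_V(\beta(x),\alpha(y),v)=-as_V(\beta(y),\alpha(x),v)$, where $as_V(x,y,v)=\mu(x,y)\cdot\psi(v)-\alpha(x)\cdot(y\cdot v)$. Right BiHom-alternative $A$-module: BiHom-module with right structure map such that $as_V(v,\beta(x),\alpha(y))=-as_V(v,\beta(y),\alpha(x))$, where $as_V(v,x,y)=(v\cdot x)\cdot\beta(y)-\phi(v)\cdot\mu(x,y)$ (all $x,y\in A$, $v\in V$). Let $J$ be a BiHom-Jordan algebra with twisting maps $\alpha,\beta$, whose product is written by juxtaposition; $\circlearrowleft_{(x,y,z)}$ denotes the sum over cyclic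 permutations. A right BiHom-Jordan $J$-module is a BiHom-module $(V,\phi,\psi)$ with a right structure map such that for all $x,y,z\in J$, $v\in V$: $$\circlearrowleft_{(x,y,z)}\{(\phi\psi^2(v)\cdot\alpha\beta(x)\alpha^2(y))\cdot\beta\alpha^3(z)-(\phi\psi^2(v)\cdot\beta\alpha^2(z))\cdot\alpha^2\beta(x)\alpha^3(y)\}=0,$$ \begin{align*}&((\psi^2(v)\cdot\beta\alpha(x))\cdot\beta\alpha^2(y))\cdot\beta\alpha^3(z)+((\psi^2(v)\cdot\beta\alpha(z))\cdot\beta\alpha^2(y))\cdot\beta\alpha^3(x)\\&+\phi^2\psi^2(v)\cdot(\beta\alpha(x)\alpha^2(z))\alpha^3(y)=(\phi\psi^2(v)\cdot\beta\alpha^2(x))\cdot\beta\alpha^2(y)\alpha^3(z)\\&+(\phi\psi^2(v)\cdot\beta\alpha^2(z))\cdot\beta\alpha^2(y)\alpha^3(x)+(\phi\psi^2(v)\cdot\beta\alpha^2(y))\cdot\alpha^2\beta(x)\alpha^3(z).\end{align*} It is called special if $\phi(v)\cdot\beta(x)\alpha(y)=(v\cdot\beta(x))\cdot\beta\alpha(y)+(v\cdot\beta(y))\cdot\alpha\beta(x)$ for all $x,y\in J$, $v\in V$. A left BiHom-Jordan $J$-module is a BiHom-module $(V,\phi,\psi)$ with $\psi$ invertible and a left structure map such that for all $x,y,z\in J$, $v\in V$: $$\circlearrowleft_{(x,y,z)}\{\beta^2\alpha^2(z)\cdot(\alpha\beta(x)\alpha^2(y)\cdot\phi^3(v))-\alpha\beta^2(x)\alpha^2\beta(y)\cdot(\beta\alpha^2(z)\cdot\phi^3(v))\}=0,$$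 \begin{align*}&\beta^2\alpha^2(z)\cdot(\beta\alpha^2(y)\cdot(\alpha^2(x)\cdot\psi^{-1}\phi^3(v)))+\beta^2\alpha^2(x)\cdot(\beta\alpha^2(y)\cdot(\alpha^2(z)\cdot\psi^{-1}\phi^3(v)))\\&+((\beta^2(x)\beta\alpha(z))\beta\alpha^2(y))\cdot\phi^3\psi(v)=\beta^2\alpha(y)\beta\alpha^2(z)\cdot(\beta\alpha^2(x)\cdot\phi^3(v))\\&+\beta^2\alpha(y)\beta\alpha^2(x)\cdot(\beta\alpha^2(z)\cdot\phi^3(v))+\beta^2\alpha(x)\beta\alpha^2(z)\cdot(\beta\alpha^2(y)\cdot\phi^3(v)).\end{align*} It is called special if $\beta(x)\alpha(y)\cdot\psi(v)=\beta\alpha(x)\cdot(\alpha(y)\cdot v)+\beta\alpha(y)\cdot(\alpha(x)\cdot v)$ for all $x,y\in J$, $v\in V$. *)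

theory Defs
  imports "HOL-Computational_Algebra.Polynomial"
begin

text \<open>Vector spaces are given by a scalar multiplication on a type of class
  \<^class>\<open>ab_group_add\<close>; the carrier is the whole type. Linear maps out of a tensor product
  are represented by the corresponding bilinear maps.\<close>

definition bilinear_map ::
  "('k::field \<Rightarrow> 'a::ab_group_add \<Rightarrow> 'a) \<Rightarrow> ('k \<Rightarrow> 'b::ab_group_add \<Rightarrow> 'b) \<Rightarrow>
   ('k \<Rightarrow> 'c::ab_group_add \<Rightarrow> 'c) \<Rightarrow> ('a \<Rightarrow> 'b \<Rightarrow> 'c) \<Rightarrow> bool" where
  "bilinear_map sa sb sc f \<longleftrightarrow>
     (\<forall>x. Vector_Spaces.linear sb sc (\<lambda>y. f x y)) \<and>
     (\<forall>y. Vector_Spaces.linear sa sc (\<lambda>x. f x y))"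

definition cyclic_sum :: "('a \<Rightarrow> 'a \<Rightarrow> 'a \<Rightarrow> 'b::ab_group_add) \<Rightarrow> 'a \<Rightarrow> 'a \<Rightarrow> 'a \<Rightarrow> 'b" where
  "cyclic_sum F x y z = F x y z + F y z x + F z x y"


section \<open>BiHom-algebras\<close>

locale bihom_algebra = vector_space scaleA
  for scaleA :: "'k::{alg_closed_field,field_char_0} \<Rightarrow> 'a::ab_group_add \<Rightarrow> 'a" +
  fixes mu :: "'a \<Rightarrow> 'a \<Rightarrow> 'a" (infixl \<open>\<star>\<close> 75)
    and \<alpha> \<beta> :: "'a \<Rightarrow> 'a"
  assumes mu_bilinear: "bilinear_map scaleA scaleA scaleA mu"
    and alpha_linear: "Vector_Spaces.linear scaleA scaleA \<alpha>"
    and beta_linear: "Vector_Spaces.linear scaleA scaleA \<beta>"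
    and alpha_beta_commute: "\<alpha> \<circ> \<beta> = \<beta> \<circ> \<alpha>"
begin

definition associator :: "'a \<Rightarrow> 'a \<Rightarrow> 'a \<Rightarrow> 'a" where
  "associator x y z = (x \<star> y) \<star> \<beta> z - \<alpha> x \<star> (y \<star> z)"

end

locale multiplicative_bihom_algebra = bihom_algebra +
  assumes alpha_mult: "\<alpha> (x \<star> y) = \<alpha> x \<star> \<alpha> y"
    and beta_mult: "\<beta> (x \<star> y) = \<beta> x \<star> \<beta> y"

locale regular_bihom_algebra = multiplicative_bihom_algebra +
  assumes alpha_bij: "bij \<alpha>"
    and beta_bij: "bij \<beta>"

locale bihom_alternative_algebra = multiplicative_bihom_algebra +
  assumes left_alternative:
      "associator (\<beta> x) (\<alpha> y) z + associator (\<beta> y) (\<alpha> x) z = 0"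
    and right_alternative:
      "associator x (\<beta> y) (\<alpha> z) + associator x (\<beta> z) (\<alpha> y) = 0"

locale regular_bihom_alternative_algebra = bihom_alternative_algebra + regular_bihom_algebra

locale bihom_jordan_algebra = multiplicative_bihom_algebra +
  assumes bihom_commutative: "\<beta> x \<star> \<alpha> y = \<beta> y \<star> \<alpha> x"
    and bihom_jordan_identity:
      "associator ((\<beta>^^2) x \<star> \<alpha> (\<beta> x)) ((\<alpha>^^2) (\<beta> y)) ((\<alpha>^^3) x) = 0"

definition plus_mult ::
  "('a::ab_group_add \<Rightarrow> 'a \<Rightarrow> 'a) \<Rightarrow> ('a \<Rightarrow> 'a) \<Rightarrow> ('a \<Rightarrow> 'a) \<Rightarrow> 'a \<Rightarrow> 'a \<Rightarrow> 'a" where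
  "plus_mult mu \<alpha> \<beta> x y = mu x y + mu (inv \<alpha> (\<beta> y)) (inv \<beta> (\<alpha> x))"


section \<open>BiHom-modules and structure maps\<close>

locale bihom_module = vector_space scaleV
  for scaleV :: "'k::{alg_closed_field,field_char_0} \<Rightarrow> 'v::ab_group_add \<Rightarrow> 'v" +
  fixes \<phi> \<psi> :: "'v \<Rightarrow> 'v"
  assumes phi_linear: "Vector_Spaces.linear scaleV scaleV \<phi>"
    and psi_linear: "Vector_Spaces.linear scaleV scaleV \<psi>"
    and phi_psi_commute: "\<phi> \<circ> \<psi> = \<psi> \<circ> \<phi>"

locale left_structure_map =
  A: bihom_algebra scaleA mu \<alpha> \<beta> + V: bihom_module scaleV \<phi> \<psi>
  for scaleA :: "'k::{alg_closed_field,field_char_0} \<Rightarrow> 'a::ab_group_add \<Rightarrow> 'a"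
    and mu :: "'a \<Rightarrow> 'a \<Rightarrow> 'a" (infixl \<open>\<star>\<close> 75)
    and \<alpha> \<beta> :: "'a \<Rightarrow> 'a"
    and scaleV :: "'k \<Rightarrow> 'v::ab_group_add \<Rightarrow> 'v"
    and \<phi> \<psi> :: "'v \<Rightarrow> 'v" +
  fixes rho :: "'a \<Rightarrow> 'v \<Rightarrow> 'v" (infixr \<open>\<cdot>\<close> 70)
  assumes rho_bilinear: "bilinear_map scaleA scaleV scaleV rho"
    and phi_rho: "\<phi> (a \<cdot> v) = \<alpha> a \<cdot> \<phi> v"
    and psi_rho: "\<psi> (a \<cdot> v) = \<beta> a \<cdot> \<psi> v"
begin

definition module_associator :: "'a \<Rightarrow> 'a \<Rightarrow> 'v \<Rightarrow> 'v" where
  "module_associator x y v = (x \<star> y) \<cdot> \<psi> v - \<alpha> x \<cdot> (y \<cdot> v)"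

end

locale right_structure_map =
  A: bihom_algebra scaleA mu \<alpha> \<beta> + V: bihom_module scaleV \<phi> \<psi>
  for scaleA :: "'k::{alg_closed_field,field_char_0} \<Rightarrow> 'a::ab_group_add \<Rightarrow> 'a"
    and mu :: "'a \<Rightarrow> 'a \<Rightarrow> 'a" (infixl \<open>\<star>\<close> 75)
    and \<alpha> \<beta> :: "'a \<Rightarrow> 'a"
    and scaleV :: "'k \<Rightarrow> 'v::ab_group_add \<Rightarrow> 'v"
    and \<phi> \<psi> :: "'v \<Rightarrow> 'v" +
  fixes rho :: "'v \<Rightarrow> 'a \<Rightarrow> 'v" (infixl \<open>\<cdot>\<close> 70)
  assumes rho_bilinear: "bilinear_map scaleV scaleA scaleV rho"
    and phi_rho: "\<phi> (v \<cdot> a) = \<phi> v \<cdot> \<alpha> a"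
    and psi_rho: "\<psi> (v \<cdot> a) = \<psi> v \<cdot> \<beta> a"
begin

definition module_associator :: "'v \<Rightarrow> 'a \<Rightarrow> 'a \<Rightarrow> 'v" where
  "module_associator v x y = (v \<cdot> x) \<cdot> \<beta> y - \<phi> v \<cdot> (x \<star> y)"

end


section \<open>Modules over BiHom-alternative algebras\<close>

locale left_bihom_alternative_module =
  left_structure_map + A: bihom_alternative_algebra scaleA mu \<alpha> \<beta> +
  assumes left_module_alternative:
    "module_associator (\<beta> x) (\<alpha> y) v = - module_associator (\<beta> y) (\<alpha> x) v"

locale right_bihom_alternative_module =
  right_structure_map + A: bihom_alternative_algebra scaleA mu \<alpha> \<beta> +
  assumes right_module_alternative:
    "module_associator v (\<beta> x) (\<alpha> y) = - module_associator v (\<beta> y) (\<alpha> x)"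


section \<open>Modules over BiHom-Jordan algebras\<close>

locale right_bihom_jordan_module =
  right_structure_map + A: bihom_jordan_algebra scaleA mu \<alpha> \<beta> +
  assumes right_jordan_1:
    "cyclic_sum (\<lambda>x y z.
        (\<phi> ((\<psi>^^2) v) \<cdot> (\<alpha> (\<beta> x) \<star> (\<alpha>^^2) y)) \<cdot> \<beta> ((\<alpha>^^3) z)
      - (\<phi> ((\<psi>^^2) v) \<cdot> \<beta> ((\<alpha>^^2) z)) \<cdot> ((\<alpha>^^2) (\<beta> x) \<star> (\<alpha>^^3) y)) x y z = 0"
    and right_jordan_2:
    "(((\<psi>^^2) v \<cdot> \<beta> (\<alpha> x)) \<cdot> \<beta> ((\<alpha>^^2) y)) \<cdot> \<beta> ((\<alpha>^^3) z)
      + (((\<psi>^^2) v \<cdot> \<beta> (\<alpha> z)) \<cdot> \<beta> ((\<alpha>^^2) y)) \<cdot> \<beta> ((\<alpha>^^3) x)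
      + (\<phi>^^2) ((\<psi>^^2) v) \<cdot> ((\<beta> (\<alpha> x) \<star> (\<alpha>^^2) z) \<star> (\<alpha>^^3) y)
     = (\<phi> ((\<psi>^^2) v) \<cdot> \<beta> ((\<alpha>^^2) x)) \<cdot> (\<beta> ((\<alpha>^^2) y) \<star> (\<alpha>^^3) z)
      + (\<phi> ((\<psi>^^2) v) \<cdot> \<beta> ((\<alpha>^^2) z)) \<cdot> (\<beta> ((\<alpha>^^2) y) \<star> (\<alpha>^^3) x)
      + (\<phi> ((\<psi>^^2) v) \<cdot> \<beta> ((\<alpha>^^2) y)) \<cdot> ((\<alpha>^^2) (\<beta> x) \<star> (\<alpha>^^3) z)"

locale right_special_bihom_jordan_module = right_bihom_jordan_module +
  assumes right_special:
    "\<phi> v \<cdot> (\<beta> x \<star> \<alpha> y) = (v \<cdot> \<beta> x) \<cdot> \<beta> (\<alpha> y) + (v \<cdot> \<beta> y) \<cdot> \<alpha> (\<beta> x)"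

locale left_bihom_jordan_module =
  left_structure_map + A: bihom_jordan_algebra scaleA mu \<alpha> \<beta> +
  assumes psi_bij: "bij \<psi>"
    and left_jordan_1:
    "cyclic_sum (\<lambda>x y z.
        (\<beta>^^2) ((\<alpha>^^2) z) \<cdot> ((\<alpha> (\<beta> x) \<star> (\<alpha>^^2) y) \<cdot> (\<phi>^^3) v)
      - (\<alpha> ((\<beta>^^2) x) \<star> (\<alpha>^^2) (\<beta> y)) \<cdot> (\<beta> ((\<alpha>^^2) z) \<cdot> (\<phi>^^3) v)) x y z = 0"
    and left_jordan_2:
    "(\<beta>^^2) ((\<alpha>^^2) z) \<cdot> (\<beta> ((\<alpha>^^2) y) \<cdot> ((\<alpha>^^2) x \<cdot> inv \<psi> ((\<phi>^^3) v)))
      + (\<beta>^^2) ((\<alpha>^^2) x) \<cdot> (\<beta> ((\<alpha>^^2) y) \<cdot> ((\<alpha>^^2) z \<cdot> inv \<psi> ((\<phi>^^3) v)))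
      + (((\<beta>^^2) x \<star> \<beta> (\<alpha> z)) \<star> \<beta> ((\<alpha>^^2) y)) \<cdot> (\<phi>^^3) (\<psi> v)
     = ((\<beta>^^2) (\<alpha> y) \<star> \<beta> ((\<alpha>^^2) z)) \<cdot> (\<beta> ((\<alpha>^^2) x) \<cdot> (\<phi>^^3) v)
      + ((\<beta>^^2) (\<alpha> y) \<star> \<beta> ((\<alpha>^^2) x)) \<cdot> (\<beta> ((\<alpha>^^2) z) \<cdot> (\<phi>^^3) v)
      + ((\<beta>^^2) (\<alpha> x) \<star> \<beta> ((\<alpha>^^2) z)) \<cdot> (\<beta> ((\<alpha>^^2) y) \<cdot> (\<phi>^^3) v)"

locale left_special_bihom_jordan_module = left_bihom_jordan_module +
  assumes left_special:
    "(\<beta> x \<star> \<alpha> y) \<cdot> \<psi> v = \<beta> (\<alpha> x) \<cdot> (\<alpha> y \<cdot> v) + \<beta> (\<alpha> y) \<cdot> (\<alpha> x \<cdot> v)"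

end

theory Submission
  imports Defs
begin

text \<open>Untwisting a regular BiHom-alternative product to \<open>x * y = \<mu> (\<alpha>\<^sup>-\<^sup>1 x) (\<beta>\<^sup>-\<^sup>1 y)\<close> gives an
  ordinary alternative product, and the plus product untwists to \<open>x * y + y * x\<close>. Hence \<open>A\<^sup>+\<close> is
  BiHom-Jordan because alternative algebras are Jordan-admissible. For the modules, the defining
  identity of a BiHom-alternative module is exactly specialness over \<open>A\<^sup>+\<close>. Specialness in turn
  expands every term of the Jordan module identities into threefold actions of the same shape, and
  these cancel.\<close>

lemma linear_iff_additive_scale:
  assumes "vector_space s1" "vector_space s2"
  shows "Vector_Spaces.linear s1 s2 f \<longleftrightarrow>
    (\<forall>x y. f (x + y) = f x + f y) \<and> (\<forall>c x. f (s1 c x) = s2 c (f x))"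
  using assms
  by (auto simp: Vector_Spaces.linear_def module_hom_def module_hom_axioms_def
      vector_space_def module_def)

section \<open>Jordan admissibility of alternative products\<close>

locale alternative_product =
  fixes mult :: "'a::ab_group_add \<Rightarrow> 'a \<Rightarrow> 'a" (infixl \<open>\<bullet>\<close> 75)
  assumes distrib_left: "x \<bullet> (y + z) = x \<bullet> y + x \<bullet> z"
    and distrib_right: "(x + y) \<bullet> z = x \<bullet> z + y \<bullet> z"
    and left_alt: "(x \<bullet> x) \<bullet> y = x \<bullet> (x \<bullet> y)"
    and right_alt: "(y \<bullet> x) \<bullet> x = y \<bullet> (x \<bullet> x)"
    and flexible: "(x \<bullet> y) \<bullet> x = x \<bullet> (y \<bullet> x)"
begin

text \<open>Since \<open>J x x\<close> is twice the square of \<open>x\<close>, each side expands to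
  twice a sum of four products, and these agree pairwise by \<open>1\<close> to \<open>4\<close>.
  For instance, both sides of \<open>1\<close> equal
  \<open>((y \<bullet> x) \<bullet> x) \<bullet> x\<close>.\<close>

lemma jordan_admissible:
  defines "J \<equiv> \<lambda>x y. x \<bullet> y + y \<bullet> x"
  shows "J (J (J x x) y) x = J (J x x) (J y x)"
proof -
  have 1: "(y \<bullet> (x \<bullet> x)) \<bullet> x = (y \<bullet> x) \<bullet> (x \<bullet> x)"
    by (metis right_alt)
  have 2: "x \<bullet> ((x \<bullet> x) \<bullet> y) = (x \<bullet> x) \<bullet> (x \<bullet> y)"
    by (metis left_alt)
  have 3: "x \<bullet> (y \<bullet> (x \<bullet> x)) = (x \<bullet> y) \<bullet> (x \<bullet> x)"
    by (metis right_alt flexible)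
  have 4: "((x \<bullet> x) \<bullet> y) \<bullet> x = (x \<bullet> x) \<bullet> (y \<bullet> x)"
    by (metis left_alt flexible)
  show ?thesis
    by (simp add: J_def distrib_left distrib_right 1 2 3 4 ac_simps)
qed

end

context bihom_algebra
begin

lemma mu_add_left: "(x + y) \<star> z = x \<star> z + y \<star> z"
  and mu_add_right: "z \<star> (x + y) = z \<star> x + z \<star> y"
  using mu_bilinear
  by (simp_all add: bilinear_map_def linear_iff_additive_scale[OF vector_space_axioms vector_space_axioms])

lemma mu_scale: "scaleA c x \<star> y = scaleA c (x \<star> y)" "x \<star> scaleA c y = scaleA c (x \<star> y)"
  using mu_bilinear
  by (simp_all add: bilinear_map_def linear_iff_additive_scale[OF vector_space_axioms vector_space_axioms])

lemma alpha_add: "\<alpha> (x + y) = \<alpha> x + \<alpha> y" and alpha_scale: "\<alpha> (scaleA c x) = scaleA c (\<alpha> x)"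
  using alpha_linear
  by (simp_all add: linear_iff_additive_scale[OF vector_space_axioms vector_space_axioms])

lemma beta_add: "\<beta> (x + y) = \<beta> x + \<beta> y" and beta_scale: "\<beta> (scaleA c x) = scaleA c (\<beta> x)"
  using beta_linear
  by (simp_all add: linear_iff_additive_scale[OF vector_space_axioms vector_space_axioms])

lemma alpha_beta_comm: "\<alpha> (\<beta> x) = \<beta> (\<alpha> x)"
  using alpha_beta_commute by (metis comp_apply)

text \<open>Characteristic 0 makes 2 invertible; this turns a skew-symmetric associator into an
  alternating one.\<close>

lemma eq_neg_imp_zero:
  fixes x :: 'a
  assumes "x = - x"
  shows "x = 0"
proof -
  have "scaleA 2 x = x + x"
    using scale_left_distrib[of 1 1 x] by simp
  also have "\<dots> = 0"
    using assms by (metis add.right_inverse)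
  finally show ?thesis
    by (simp add: scale_eq_0_iff)
qed

end

section \<open>The plus product and the untwisted product\<close>

context regular_bihom_algebra
begin

lemma inverse_simps [simp]:
  "\<alpha> (inv \<alpha> x) = x" "inv \<alpha> (\<alpha> x) = x" "\<beta> (inv \<beta> x) = x" "inv \<beta> (\<beta> x) = x"
  using alpha_bij beta_bij by (simp_all add: bij_is_surj surj_f_inv_f bij_is_inj inv_f_f)

lemma inv_alpha_beta: "inv \<alpha> (\<beta> x) = \<beta> (inv \<alpha> x)"
  by (metis inverse_simps(1,2) alpha_beta_comm)

lemma inv_beta_alpha: "inv \<beta> (\<alpha> x) = \<alpha> (inv \<beta> x)"
  by (metis inverse_simps(3,4) alpha_beta_comm)

lemma plus_mult_eq:
  "plus_mult mu \<alpha> \<beta> x y = x \<star> y + inv \<alpha> (\<beta> y) \<star> inv \<beta> (\<alpha> x)"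
  by (simp add: plus_mult_def)

text \<open>Both inverse twists cancel on arguments of this shape, the one in which commutativity
  and specialness are stated.\<close>

lemma plus_mult_twisted:
  "plus_mult mu \<alpha> \<beta> (\<beta> x) (\<alpha> y) = \<beta> x \<star> \<alpha> y + \<beta> y \<star> \<alpha> x"
  by (simp add: plus_mult_eq inv_alpha_beta inv_beta_alpha)

lemma inv_alpha_add: "inv \<alpha> (x + y) = inv \<alpha> x + inv \<alpha> y"
  by (metis alpha_add inverse_simps(1,2))

lemma inv_beta_add: "inv \<beta> (x + y) = inv \<beta> x + inv \<beta> y"
  by (metis beta_add inverse_simps(3,4))

lemma inv_alpha_scale: "inv \<alpha> (scaleA c x) = scaleA c (inv \<alpha> x)"
  by (metis alpha_scale inverse_simps(1,2))

lemma inv_beta_scale: "inv \<beta> (scaleA c x) = scaleA c (inv \<beta> x)"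
  by (metis beta_scale inverse_simps(3,4))

lemma plus_multiplicative: "multiplicative_bihom_algebra scaleA (plus_mult mu \<alpha> \<beta>) \<alpha> \<beta>"
proof unfold_locales
  show "bilinear_map scaleA scaleA scaleA (plus_mult mu \<alpha> \<beta>)"
    by (simp add: bilinear_map_def linear_iff_additive_scale[OF vector_space_axioms vector_space_axioms]
        plus_mult_eq mu_add_left mu_add_right mu_scale alpha_add beta_add alpha_scale beta_scale
        inv_alpha_add inv_beta_add inv_alpha_scale inv_beta_scale scale_right_distrib)
  show "\<alpha> (plus_mult mu \<alpha> \<beta> x y) = plus_mult mu \<alpha> \<beta> (\<alpha> x) (\<alpha> y)" for x y
    by (simp add: plus_mult_eq alpha_add alpha_mult inv_beta_alpha alpha_beta_comm[symmetric])
  show "\<beta> (plus_mult mu \<alpha> \<beta> x y) = plus_mult mu \<alpha> \<beta> (\<beta> x) (\<beta> y)" for x y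
    by (simp add: plus_mult_eq beta_add beta_mult inv_alpha_beta alpha_beta_comm)
qed (fact alpha_add alpha_scale beta_add beta_scale alpha_beta_commute)+

definition untwisted :: "'b \<Rightarrow> 'b \<Rightarrow> 'b" (infixl \<open>\<bullet>\<close> 75)
  where "x \<bullet> y = inv \<alpha> x \<star> inv \<beta> y"

lemma mu_eq_untwisted: "x \<star> y = \<alpha> x \<bullet> \<beta> y"
  by (simp add: untwisted_def)

lemma plus_mult_untwisted: "plus_mult mu \<alpha> \<beta> x y = \<alpha> x \<bullet> \<beta> y + \<beta> y \<bullet> \<alpha> x"
  by (simp add: plus_mult_eq untwisted_def)

lemma alpha_untwisted: "\<alpha> (x \<bullet> y) = \<alpha> x \<bullet> \<alpha> y"
  by (simp add: untwisted_def alpha_mult inv_beta_alpha)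

lemma beta_untwisted: "\<beta> (x \<bullet> y) = \<beta> x \<bullet> \<beta> y"
  by (simp add: untwisted_def beta_mult inv_alpha_beta)

text \<open>Both twisting maps are automorphisms of \<open>\<bullet>\<close>, so all twists move
  onto the arguments. As the maps are bijective, every ordinary associator of
  \<open>\<bullet>\<close> arises in this way.\<close>

lemma associator_untwisted:
  "associator x y z =
    (\<alpha> (\<alpha> x) \<bullet> \<alpha> (\<beta> y)) \<bullet> \<beta> (\<beta> z) - \<alpha> (\<alpha> x) \<bullet> (\<alpha> (\<beta> y) \<bullet> \<beta> (\<beta> z))"
  by (simp add: associator_def mu_eq_untwisted alpha_untwisted beta_untwisted alpha_beta_comm)

end

section \<open>From BiHom-alternative to BiHom-Jordan algebras\<close>

context regular_bihom_alternative_algebra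
begin

lemma untwisted_alternative: "alternative_product (\<bullet>)"
proof -
  define as where "as x y z = (x \<bullet> y) \<bullet> z - x \<bullet> (y \<bullet> z)" for x y z
  \<comment> \<open>The inverse twists put into the axiom, here and for \<open>as_right\<close>, are
    those that \<open>associator_untwisted\<close> cancels, leaving bare \<open>x\<close>,
    \<open>y\<close>, \<open>z\<close>.\<close>
  have as_left: "as x y z = - as y x z" for x y z
    using left_alternative[of "inv \<beta> (inv \<alpha> (inv \<alpha> x))" "inv \<beta> (inv \<alpha> (inv \<alpha> y))" "inv \<beta> (inv \<beta> z)"]
    by (simp add: associator_untwisted as_def alpha_beta_comm[symmetric] eq_neg_iff_add_eq_0
        del: minus_diff_eq)
  have as_right: "as x y z = - as x z y" for x y z
    using right_alternative[of "inv \<alpha> (inv \<alpha> x)" "inv \<alpha> (inv \<beta> (inv \<beta> y))" "inv \<alpha> (inv \<beta> (inv \<beta> z))"]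
    by (simp add: associator_untwisted as_def alpha_beta_comm eq_neg_iff_add_eq_0
        del: minus_diff_eq)
  have l: "as x x y = 0" and r: "as y x x = 0" for x y
    by (rule eq_neg_imp_zero, fact as_left, rule eq_neg_imp_zero, fact as_right)
  \<comment> \<open>Flexibility: swapping the first two arguments reduces it to
    \<open>r\<close>.\<close>
  have "as x y x = 0" for x y
    using as_left[of x y x] r by simp
  with l r show ?thesis
    by unfold_locales
      (simp_all add: as_def untwisted_def inv_alpha_add inv_beta_add mu_add_left mu_add_right)
qed

lemma plus_jordan: "bihom_jordan_algebra scaleA (plus_mult mu \<alpha> \<beta>) \<alpha> \<beta>"
proof -
  interpret P: multiplicative_bihom_algebra scaleA "plus_mult mu \<alpha> \<beta>" \<alpha> \<beta>
    by (rule plus_multiplicative)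
  interpret U: alternative_product "(\<bullet>)"
    by (rule untwisted_alternative)
  show ?thesis
  proof unfold_locales
    fix x y
    show "plus_mult mu \<alpha> \<beta> (\<beta> x) (\<alpha> y) = plus_mult mu \<alpha> \<beta> (\<beta> y) (\<alpha> x)"
      by (simp add: plus_mult_twisted add.commute)
    \<comment> \<open>The exponents in the Jordan identity are balanced: after untwisting, every
      occurrence of \<open>x\<close> carries three \<open>\<alpha>\<close> and two
      \<open>\<beta>\<close>, and so does \<open>y\<close>. What remains is the ordinary identity at
      \<open>X\<close> and \<open>Y\<close>.\<close>
    define X Y where "X = \<alpha> (\<alpha> (\<alpha> (\<beta> (\<beta> x))))" and "Y = \<alpha> (\<alpha> (\<alpha> (\<beta> (\<beta> y))))"
    show "P.associator (plus_mult mu \<alpha> \<beta> ((\<beta> ^^ 2) x) (\<alpha> (\<beta> x)))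
        ((\<alpha> ^^ 2) (\<beta> y)) ((\<alpha> ^^ 3) x) = 0"
      using U.jordan_admissible[of X Y]
      by (simp add: P.associator_def plus_mult_untwisted numeral_2_eq_2 numeral_3_eq_3
          alpha_untwisted beta_untwisted alpha_add beta_add alpha_beta_comm[symmetric] X_def Y_def)
  qed
qed

end

section \<open>Special right modules satisfy the Jordan identities\<close>

context right_structure_map
begin

lemma rho_add_left: "(v + w) \<cdot> x = v \<cdot> x + w \<cdot> x"
  and rho_add_right: "v \<cdot> (x + y) = v \<cdot> x + v \<cdot> y"
  using rho_bilinear
  by (simp_all add: bilinear_map_def
      linear_iff_additive_scale[OF V.vector_space_axioms V.vector_space_axioms]
      linear_iff_additive_scale[OF A.vector_space_axioms V.vector_space_axioms])

text \<open>Surjectivity of \<open>\<beta>\<close> is what lets specialness apply to the product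
  \<open>(\<alpha>\<beta>(x) \<alpha>\<^sup>2(z)) \<alpha>\<^sup>3(y)\<close>, whose left factor must be of the form \<open>\<beta>(_)\<close>.\<close>

lemma special_imp_jordan:
  assumes "bihom_jordan_algebra scaleA mu \<alpha> \<beta>" and "surj \<beta>"
    and special: "\<And>v x y. \<phi> v \<cdot> (\<beta> x \<star> \<alpha> y) = (v \<cdot> \<beta> x) \<cdot> \<beta> (\<alpha> y) + (v \<cdot> \<beta> y) \<cdot> \<alpha> (\<beta> x)"
  shows "right_special_bihom_jordan_module scaleA mu \<alpha> \<beta> scaleV \<phi> \<psi> (\<cdot>)"
proof -
  interpret J: bihom_jordan_algebra scaleA mu \<alpha> \<beta>
    by fact
  have expand: "\<phi> v \<cdot> (b \<star> \<alpha> y) = (v \<cdot> b) \<cdot> \<alpha> (\<beta> y) + (v \<cdot> \<beta> y) \<cdot> \<alpha> b" for v b y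
    using special[of v _ y] \<open>surj \<beta>\<close> by (metis surjD A.alpha_beta_comm)
  \<comment> \<open>The acted vector \<open>\<phi> v \<cdot> \<alpha> a\<close> is
    \<open>\<phi> (v \<cdot> a)\<close>, so specialness applies at
    \<open>v \<cdot> a\<close>.\<close>
  have expand_acted: "(\<phi> v \<cdot> \<alpha> a) \<cdot> (b \<star> \<alpha> y) =
      ((v \<cdot> a) \<cdot> b) \<cdot> \<alpha> (\<beta> y) + ((v \<cdot> a) \<cdot> \<beta> y) \<cdot> \<alpha> b" for v a b y
    using expand[of "v \<cdot> a"] by (simp add: phi_rho)
  note expand_simps = numeral_2_eq_2 numeral_3_eq_3 expand expand_acted rho_add_left
    A.alpha_beta_comm[symmetric] J.alpha_mult J.beta_mult
  show ?thesis
  proof unfold_locales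
    fix v x y z
    \<comment> \<open>Write \<open>T a b c\<close> for \<open>((w \<cdot> \<alpha> (\<beta> a))
      \<cdot> (\<alpha>^^2) (\<beta> b)) \<cdot> (\<alpha>^^3) (\<beta> c)\<close> with
      \<open>w = (\<psi>^^2) v\<close>. The summand is
      \<open>T x y z + T y x z - T z x y - T z y x\<close>, and even and odd orders cancel
      separately in the cyclic sum.\<close>
    show "cyclic_sum (\<lambda>x y z.
        (\<phi> ((\<psi>^^2) v) \<cdot> (\<alpha> (\<beta> x) \<star> (\<alpha>^^2) y)) \<cdot> \<beta> ((\<alpha>^^3) z)
      - (\<phi> ((\<psi>^^2) v) \<cdot> \<beta> ((\<alpha>^^2) z)) \<cdot> ((\<alpha>^^2) (\<beta> x) \<star> (\<alpha>^^3) y)) x y z = 0"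
      by (simp add: cyclic_sum_def expand_simps)
    \<comment> \<open>Both sides are the sum of \<open>T\<close> over all six orders of
      \<open>x\<close>, \<open>y\<close>, \<open>z\<close>; on the left, the iterated product
      contributes four of them.\<close>
    show "(((\<psi>^^2) v \<cdot> \<beta> (\<alpha> x)) \<cdot> \<beta> ((\<alpha>^^2) y)) \<cdot> \<beta> ((\<alpha>^^3) z)
      + (((\<psi>^^2) v \<cdot> \<beta> (\<alpha> z)) \<cdot> \<beta> ((\<alpha>^^2) y)) \<cdot> \<beta> ((\<alpha>^^3) x)
      + (\<phi>^^2) ((\<psi>^^2) v) \<cdot> ((\<beta> (\<alpha> x) \<star> (\<alpha>^^2) z) \<star> (\<alpha>^^3) y)
     = (\<phi> ((\<psi>^^2) v) \<cdot> \<beta> ((\<alpha>^^2) x)) \<cdot> (\<beta> ((\<alpha>^^2) y) \<star> (\<alpha>^^3) z)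
      + (\<phi> ((\<psi>^^2) v) \<cdot> \<beta> ((\<alpha>^^2) z)) \<cdot> (\<beta> ((\<alpha>^^2) y) \<star> (\<alpha>^^3) x)
      + (\<phi> ((\<psi>^^2) v) \<cdot> \<beta> ((\<alpha>^^2) y)) \<cdot> ((\<alpha>^^2) (\<beta> x) \<star> (\<alpha>^^3) z)"
      by (simp add: expand_simps ac_simps)
  qed (fact special)
qed

end

section \<open>Special left modules satisfy the Jordan identities\<close>

context left_structure_map
begin

lemma rho_add_left: "(x + y) \<cdot> v = x \<cdot> v + y \<cdot> v"
  and rho_add_right: "x \<cdot> (v + w) = x \<cdot> v + x \<cdot> w"
  using rho_bilinear
  by (simp_all add: bilinear_map_def
      linear_iff_additive_scale[OF V.vector_space_axioms V.vector_space_axioms]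
      linear_iff_additive_scale[OF A.vector_space_axioms V.vector_space_axioms])

lemma phi_psi_comm: "\<phi> (\<psi> v) = \<psi> (\<phi> v)"
  using V.phi_psi_commute by (metis comp_apply)

text \<open>Specialness now needs a vector of the form \<open>\<psi> _\<close>, which bijectivity of
  \<open>\<psi>\<close> supplies. The left factor
  \<open>(\<beta>^^2) x \<star> \<beta> (\<alpha> z)\<close> is already in the image of
  \<open>\<beta>\<close> by multiplicativity.\<close>

lemma special_imp_jordan:
  assumes "bihom_jordan_algebra scaleA mu \<alpha> \<beta>" and "bij \<psi>"
    and special: "\<And>v x y. (\<beta> x \<star> \<alpha> y) \<cdot> \<psi> v = \<beta> (\<alpha> x) \<cdot> (\<alpha> y \<cdot> v) + \<beta> (\<alpha> y) \<cdot> (\<alpha> x \<cdot> v)"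
  shows "left_special_bihom_jordan_module scaleA mu \<alpha> \<beta> scaleV \<phi> \<psi> (\<cdot>)"
proof -
  interpret J: bihom_jordan_algebra scaleA mu \<alpha> \<beta>
    by fact
  \<comment> \<open>Rewriting moves \<open>\<beta>\<close> outward, so a right factor
    \<open>\<alpha> (\<beta> y)\<close> shows up as \<open>\<beta> (\<alpha> y)\<close>; specialness
    is restated in that form.\<close>
  have expand: "(\<beta> x \<star> \<beta> (\<alpha> y)) \<cdot> \<psi> v = \<beta> (\<alpha> x) \<cdot> (\<beta> (\<alpha> y) \<cdot> v) + \<beta> (\<beta> (\<alpha> y)) \<cdot> (\<alpha> x \<cdot> v)"
    for x y v
    using special[of x "\<beta> y" v] by (simp add: A.alpha_beta_comm)
  have expand_product: "((\<beta> x \<star> \<beta> z) \<star> \<beta> (\<alpha> y)) \<cdot> \<psi> v =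
      (\<beta> (\<alpha> x) \<star> \<beta> (\<alpha> z)) \<cdot> (\<beta> (\<alpha> y) \<cdot> v) + \<beta> (\<beta> (\<alpha> y)) \<cdot> ((\<alpha> x \<star> \<alpha> z) \<cdot> v)" for x y z v
    using expand[of "x \<star> z" y v] by (simp add: J.alpha_mult J.beta_mult)
  have expand_acted: "(\<beta> x \<star> \<beta> (\<alpha> y)) \<cdot> (\<beta> a \<cdot> \<psi> v) =
      \<beta> (\<alpha> x) \<cdot> (\<beta> (\<alpha> y) \<cdot> (a \<cdot> v)) + \<beta> (\<beta> (\<alpha> y)) \<cdot> (\<alpha> x \<cdot> (a \<cdot> v))" for x y a v
    using expand[of x y "a \<cdot> v"] by (simp add: psi_rho)
  note expand_simps = numeral_2_eq_2 numeral_3_eq_3 special expand expand_product expand_acted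
    rho_add_right A.alpha_beta_comm phi_psi_comm
  show ?thesis
  proof unfold_locales
    fix v x y z
    \<comment> \<open>This \<open>u\<close> is the vector \<open>inv \<psi> ((\<phi>^^3) v)\<close>
      of the second identity, so all threefold actions end in the same \<open>u\<close>.\<close>
    obtain u where u: "\<phi> (\<phi> (\<phi> v)) = \<psi> u"
      using \<open>bij \<psi>\<close> by (metis bij_is_surj surjD)
    then have inv_u: "inv \<psi> (\<psi> u) = u"
      using \<open>bij \<psi>\<close> by (simp add: bij_is_inj)
    \<comment> \<open>As for right modules, with \<open>(\<beta>^^2) ((\<alpha>^^2) a) \<cdot>
      (\<beta> ((\<alpha>^^2) b) \<cdot> ((\<alpha>^^2) c \<cdot> u))\<close> in place of
      \<open>T a b c\<close>.\<close>
    show "cyclic_sum (\<lambda>x y z.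
        (\<beta>^^2) ((\<alpha>^^2) z) \<cdot> ((\<alpha> (\<beta> x) \<star> (\<alpha>^^2) y) \<cdot> (\<phi>^^3) v)
      - (\<alpha> ((\<beta>^^2) x) \<star> (\<alpha>^^2) (\<beta> y)) \<cdot> (\<beta> ((\<alpha>^^2) z) \<cdot> (\<phi>^^3) v)) x y z = 0"
      by (simp add: cyclic_sum_def expand_simps u)
    show "(\<beta>^^2) ((\<alpha>^^2) z) \<cdot> (\<beta> ((\<alpha>^^2) y) \<cdot> ((\<alpha>^^2) x \<cdot> inv \<psi> ((\<phi>^^3) v)))
      + (\<beta>^^2) ((\<alpha>^^2) x) \<cdot> (\<beta> ((\<alpha>^^2) y) \<cdot> ((\<alpha>^^2) z \<cdot> inv \<psi> ((\<phi>^^3) v)))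
      + (((\<beta>^^2) x \<star> \<beta> (\<alpha> z)) \<star> \<beta> ((\<alpha>^^2) y)) \<cdot> (\<phi>^^3) (\<psi> v)
     = ((\<beta>^^2) (\<alpha> y) \<star> \<beta> ((\<alpha>^^2) z)) \<cdot> (\<beta> ((\<alpha>^^2) x) \<cdot> (\<phi>^^3) v)
      + ((\<beta>^^2) (\<alpha> y) \<star> \<beta> ((\<alpha>^^2) x)) \<cdot> (\<beta> ((\<alpha>^^2) z) \<cdot> (\<phi>^^3) v)
      + ((\<beta>^^2) (\<alpha> x) \<star> \<beta> ((\<alpha>^^2) z)) \<cdot> (\<beta> ((\<alpha>^^2) y) \<cdot> (\<phi>^^3) v)"
      by (simp add: expand_simps u inv_u ac_simps)
  qed (fact \<open>bij \<psi>\<close> special)+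
qed

end

section \<open>Alternative modules as special Jordan modules over the plus algebra\<close>

theorem proposition4p18:
  fixes scaleA :: "'k::{alg_closed_field,field_char_0} \<Rightarrow> 'a::ab_group_add \<Rightarrow> 'a"
    and mu :: "'a \<Rightarrow> 'a \<Rightarrow> 'a"
    and \<alpha> \<beta> :: "'a \<Rightarrow> 'a"
    and scaleV :: "'k \<Rightarrow> 'v::ab_group_add \<Rightarrow> 'v"
    and \<phi> \<psi> :: "'v \<Rightarrow> 'v"
  assumes "regular_bihom_alternative_algebra scaleA mu \<alpha> \<beta>"
    and "bihom_module scaleV \<phi> \<psi>"
  shows "(\<forall>rho_r.
            right_bihom_alternative_module scaleA mu \<alpha> \<beta> scaleV \<phi> \<psi> rho_r \<longrightarrow>
            right_special_bihom_jordan_module scaleA (plus_mult mu \<alpha> \<beta>) \<alpha> \<beta> scaleV \<phi> \<psi> rho_r) \<and>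
         (\<forall>rho_l.
            left_bihom_alternative_module scaleA mu \<alpha> \<beta> scaleV \<phi> \<psi> rho_l \<and> bij \<psi> \<longrightarrow>
            left_special_bihom_jordan_module scaleA (plus_mult mu \<alpha> \<beta>) \<alpha> \<beta> scaleV \<phi> \<psi> rho_l)"
proof (intro conjI allI impI; (elim conjE)?)
  interpret R: regular_bihom_alternative_algebra scaleA mu \<alpha> \<beta>
    by fact
  interpret P: bihom_jordan_algebra scaleA "plus_mult mu \<alpha> \<beta>" \<alpha> \<beta>
    by (rule R.plus_jordan)
  have "surj \<beta>"
    using R.beta_bij by (rule bij_is_surj)
  {
    fix rho
    assume "right_bihom_alternative_module scaleA mu \<alpha> \<beta> scaleV \<phi> \<psi> rho"
    then interpret M: right_bihom_alternative_module scaleA mu \<alpha> \<beta> scaleV \<phi> \<psi> rho .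
    \<comment> \<open>The conditions on a structure map mention the twisting maps but not the
      product, so they carry over to the plus algebra.\<close>
    interpret S: right_structure_map scaleA "plus_mult mu \<alpha> \<beta>" \<alpha> \<beta> scaleV \<phi> \<psi> rho
      by unfold_locales (fact M.rho_bilinear M.phi_rho M.psi_rho)+
    show "right_special_bihom_jordan_module scaleA (plus_mult mu \<alpha> \<beta>) \<alpha> \<beta> scaleV \<phi> \<psi> rho"
    proof (rule S.special_imp_jordan)
      fix v x y
      \<comment> \<open>Bringing the product terms of both associators to one side, additivity of
        \<open>rho\<close> merges them into the action of the plus product.\<close>
      show "rho (\<phi> v) (plus_mult mu \<alpha> \<beta> (\<beta> x) (\<alpha> y)) =
          rho (rho v (\<beta> x)) (\<beta> (\<alpha> y)) + rho (rho v (\<beta> y)) (\<alpha> (\<beta> x))"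
        using M.right_module_alternative[of v x y]
        by (simp add: M.module_associator_def R.plus_mult_twisted M.rho_add_right
            R.alpha_beta_comm algebra_simps)
    qed (fact P.bihom_jordan_algebra_axioms \<open>surj \<beta>\<close>)+
  }
  {
    fix rho
    assume "left_bihom_alternative_module scaleA mu \<alpha> \<beta> scaleV \<phi> \<psi> rho" and "bij \<psi>"
    then interpret M: left_bihom_alternative_module scaleA mu \<alpha> \<beta> scaleV \<phi> \<psi> rho
      by simp
    interpret S: left_structure_map scaleA "plus_mult mu \<alpha> \<beta>" \<alpha> \<beta> scaleV \<phi> \<psi> rho
      by unfold_locales (fact M.rho_bilinear M.phi_rho M.psi_rho)+
    show "left_special_bihom_jordan_module scaleA (plus_mult mu \<alpha> \<beta>) \<alpha> \<beta> scaleV \<phi> \<psi> rho"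
    proof (rule S.special_imp_jordan)
      fix v x y
      show "rho (plus_mult mu \<alpha> \<beta> (\<beta> x) (\<alpha> y)) (\<psi> v) =
          rho (\<beta> (\<alpha> x)) (rho (\<alpha> y) v) + rho (\<beta> (\<alpha> y)) (rho (\<alpha> x) v)"
        using M.left_module_alternative[of x y v]
        by (simp add: M.module_associator_def R.plus_mult_twisted M.rho_add_left
            R.alpha_beta_comm algebra_simps)
    qed (fact P.bihom_jordan_algebra_axioms \<open>bij \<psi>\<close>)+
  }
qed

end
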